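(* Let $n\geq 6$ and let $i$ be an integer with $\lfloor n/3\rfloor+2\leq i\leq \lfloor n/2\rfloor$. Then $$d_a(C_n,i)\geq \sum_{k=3}^{i-1}(k+2)\,d(P_{n-k-2},i-k).$$
   Context: $C_n$ denotes the cycle on $n$ vertices and $P_m$ the path on $m$ vertices. A dominating set of a graph $G=(V,E)$ is a set $D\subseteq V$ such that every vertex not in $D$ is adjacent to some vertex of $D$. A dominating set $D$ is accurate if no $|D|$-element subset of $V\setminus D$ is a dominating set of $G$. $d(G,j)$ is the number of dominating sets of $G$ of cardinality $j$ and $d_a(G,j)$ the number of accurate dominating sets of $G$ of cardinality $j$. Empty sums are $0$. *)

theory Defs
  imports Main
begin

(* A graph is a pair (V, E) of a vertex set and a set of undirected edges {u, v}. *)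
type_synonym 'a graph = "'a set \<times> 'a set set"

abbreviation verts :: "'a graph \<Rightarrow> 'a set" where
  "verts G \<equiv> fst G"

abbreviation edges :: "'a graph \<Rightarrow> 'a set set" where
  "edges G \<equiv> snd G"

definition adjacent :: "'a graph \<Rightarrow> 'a \<Rightarrow> 'a \<Rightarrow> bool" where
  "adjacent G u v \<longleftrightarrow> {u, v} \<in> edges G"

(* The cycle is a simple graph only for n >= 3; for smaller n the value is not meaningful. *)
definition cycle_graph :: "nat \<Rightarrow> nat graph" where
  "cycle_graph n = ({..<n}, {{v, Suc v mod n} | v. v < n})"

(* m counts vertices, so path_graph m has m - 1 edges. *)
definition path_graph :: "nat \<Rightarrow> nat graph" where
  "path_graph m = ({..<m}, {{v, Suc v} | v. Suc v < m})"

definition dominating_set :: "'a graph \<Rightarrow> 'a set \<Rightarrow> bool" where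
  "dominating_set G D \<longleftrightarrow>
     D \<subseteq> verts G \<and> (\<forall>v \<in> verts G - D. \<exists>u \<in> D. adjacent G v u)"

(* card is cardinality only on finite sets, so accuracy and the counts below are meant for finite graphs. *)
definition accurate_dominating_set :: "'a graph \<Rightarrow> 'a set \<Rightarrow> bool" where
  "accurate_dominating_set G D \<longleftrightarrow>
     dominating_set G D \<and>
     \<not> (\<exists>D'. D' \<subseteq> verts G - D \<and> card D' = card D \<and> dominating_set G D')"

definition num_dominating_sets :: "'a graph \<Rightarrow> nat \<Rightarrow> nat" where
  "num_dominating_sets G j = card {D. dominating_set G D \<and> card D = j}"

definition num_accurate_dominating_sets :: "'a graph \<Rightarrow> nat \<Rightarrow> nat" where
  "num_accurate_dominating_sets G j = card {D. accurate_dominating_set G D \<and> card D = j}"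

end

(* If D contains three consecutive vertices of the cycle, no set disjoint from D dominates the
   middle one, so a dominating D is accurate. Such D arise by placing, after an arbitrary vertex s,
   a run of k >= 3 vertices, one gap, and a dominating set of the path on the remaining n - k - 2
   vertices, with s as the other gap. A vertex j in the run together with D determines this
   decomposition, since the run is the maximal one around j. Counting the pairs (j, D) gives
   n * (SUM k. k * d(P_(n-k-2), i-k)) <= i * d_a(C_n, i), and k + 2 <= 2k with 2i <= n finishes. *)
theory Submission
  imports Defs
begin

text \<open>Positions are relative to a start vertex. Positions 0 and \<open>k + 1\<close> stay
  empty, and a tail \<open>S\<close> inside \<open>{..<n - k - 2}\<close> fills part of
  \<open>k + 2\<close>, ..., \<open>n - 1\<close>. After \<open>n - 1\<close> the cycle returns to
  the gap 0, so the run is bounded on both sides.\<close>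

definition run_with_tail :: "nat \<Rightarrow> nat set \<Rightarrow> nat set" where
  "run_with_tail k S = {1..k} \<union> (\<lambda>x. x + k + 2) ` S"

definition rotate_set :: "nat \<Rightarrow> nat \<Rightarrow> nat set \<Rightarrow> nat set" where
  "rotate_set n s T = (\<lambda>y. (s + y) mod n) ` T"

section \<open>Rotations of the residues modulo \<open>n\<close>\<close>

lemma mod_add_left_inj:
  fixes n s x y :: nat
  assumes "x < n" "y < n" "(s + x) mod n = (s + y) mod n"
  shows "x = y"
proof -
  \<comment> \<open>Over the integers the difference is not truncated, so \<open>s\<close> cancels
    from the congruence.\<close>
  have "int n dvd (int (s + x) - int (s + y))"
    using assms(3) by (metis mod_eq_dvd_iff of_nat_mod)
  then have "int x mod int n = int y mod int n"
    by (simp add: mod_eq_dvd_iff)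
  then show ?thesis using assms(1,2) by simp
qed

lemma inj_on_mod_add: "inj_on (\<lambda>y. (s + y) mod n) {..<n::nat}"
  by (rule inj_onI) (auto dest: mod_add_left_inj)

lemma mod_add_surj:
  fixes v n s :: nat
  assumes "v < n"
  obtains y where "y < n" "v = (s + y) mod n"
proof -
  have "(\<lambda>y. (s + y) mod n) ` {..<n} = {..<n}"
    using assms by (intro endo_inj_surj inj_on_mod_add) auto
  then have "v \<in> (\<lambda>y. (s + y) mod n) ` {..<n}" using assms by simp
  then show ?thesis using that by auto
qed

lemma mem_rotate_set_iff:
  assumes "T \<subseteq> {..<n}" "y < n"
  shows "(s + y) mod n \<in> rotate_set n s T \<longleftrightarrow> y \<in> T"
  using assms unfolding rotate_set_def by (auto dest: mod_add_left_inj)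

lemma rotate_set_subset: "n > 0 \<Longrightarrow> rotate_set n s T \<subseteq> {..<n}"
  by (auto simp: rotate_set_def)

lemma card_rotate_set: "T \<subseteq> {..<n} \<Longrightarrow> card (rotate_set n s T) = card T"
  unfolding rotate_set_def by (rule card_image) (rule inj_on_subset[OF inj_on_mod_add])

lemma rotate_set_cancel:
  assumes "T \<subseteq> {..<n}" "T' \<subseteq> {..<n}" "rotate_set n s T = rotate_set n s T'"
  shows "T = T'"
  using assms inj_on_image_eq_iff[OF inj_on_mod_add] unfolding rotate_set_def by blast

section \<open>Runs with a tail\<close>

lemma run_with_tail_subset:
  assumes "S \<subseteq> {..<n - k - 2}" "k + 2 \<le> n"
  shows "run_with_tail k S \<subseteq> {..<n}"
  using assms by (auto simp: run_with_tail_def)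

lemma run_mem_run_with_tail: "1 \<le> y \<Longrightarrow> y \<le> k \<Longrightarrow> y \<in> run_with_tail k S"
  by (auto simp: run_with_tail_def)

lemma gap_notin_run_with_tail: "0 \<notin> run_with_tail k S" "Suc k \<notin> run_with_tail k S"
  by (auto simp: run_with_tail_def)

lemma tail_mem_run_with_tail_iff: "x + k + 2 \<in> run_with_tail k S \<longleftrightarrow> x \<in> S"
  by (auto simp: run_with_tail_def)

lemma card_run_with_tail:
  assumes "finite S"
  shows "card (run_with_tail k S) = k + card S"
proof -
  have "card ((\<lambda>x. x + k + 2) ` S) = card S" by (rule card_image) (auto simp: inj_on_def)
  then show ?thesis
    unfolding run_with_tail_def using assms by (subst card_Un_disjoint) auto
qed

text \<open>The first positive position missing from the set is \<open>Suc k\<close>: if one run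
  were longer, it would cover the gap that ends the other. Once \<open>k\<close> is known, the tail
  is read off from \<open>k + 2\<close> on.\<close>

lemma run_with_tail_inject:
  assumes "run_with_tail k S = run_with_tail k' S'"
  shows "k = k' \<and> S = S'"
proof -
  have "Suc k \<notin> run_with_tail k' S'" "Suc k' \<notin> run_with_tail k S"
    unfolding assms[symmetric]
    by (rule gap_notin_run_with_tail(2)) (unfold assms, rule gap_notin_run_with_tail(2))
  then have "\<not> Suc k \<le> k'" "\<not> Suc k' \<le> k"
    using run_mem_run_with_tail[of "Suc k" k' S'] run_mem_run_with_tail[of "Suc k'" k S] by auto
  then have k: "k = k'" by simp
  have "x \<in> S \<longleftrightarrow> x \<in> S'" for x
    using tail_mem_run_with_tail_iff[of x k S] tail_mem_run_with_tail_iff[of x k S']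
    unfolding assms[folded k] by blast
  then show ?thesis using k by blast
qed

section \<open>Domination and accuracy in the cycle\<close>

text \<open>Writing the vertex as \<open>Suc a mod n\<close> makes its predecessor
  \<open>a mod n\<close>, so no subtraction modulo \<open>n\<close> occurs.\<close>

lemma adjacent_cycle_graph_mod_iff:
  assumes "n > 0"
  shows "adjacent (cycle_graph n) (Suc a mod n) u \<longleftrightarrow>
    u = a mod n \<or> u = Suc (Suc a) mod n"
proof
  assume "adjacent (cycle_graph n) (Suc a mod n) u"
  then obtain v where v: "v < n" and e: "{Suc a mod n, u} = {v, Suc v mod n}"
    by (auto simp: adjacent_def cycle_graph_def)
  from e consider "v = Suc a mod n" "u = Suc v mod n" | "u = v" "Suc v mod n = Suc a mod n"
    by (auto simp: doubleton_eq_iff)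
  then show "u = a mod n \<or> u = Suc (Suc a) mod n"
  proof cases
    case 1
    then show ?thesis by (simp add: mod_Suc_eq)
  next
    case 2
    \<comment> \<open>The successor is written as a rotation by 1, which
      \<open>mod_add_left_inj\<close> cancels.\<close>
    then have "(1 + v) mod n = (1 + a mod n) mod n" by (simp add: mod_Suc_eq)
    then have "v = a mod n"
      using v assms by (metis mod_add_left_inj mod_less_divisor)
    then show ?thesis using 2(1) by blast
  qed
next
  have step: "{v mod n, Suc v mod n} \<in> edges (cycle_graph n)" for v
  proof -
    have "v mod n < n" using assms by simp
    moreover have "Suc (v mod n) mod n = Suc v mod n" by (rule mod_Suc_eq)
    ultimately show ?thesis unfolding cycle_graph_def snd_conv
      by (metis (mono_tags, lifting) mem_Collect_eq)
  qed
  assume "u = a mod n \<or> u = Suc (Suc a) mod n"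
  then show "adjacent (cycle_graph n) (Suc a mod n) u"
    unfolding adjacent_def using step[of a] step[of "Suc a"] by (metis insert_commute)
qed

lemma adjacent_cycle_graph_Suc:
  assumes "n > 0"
  shows "adjacent (cycle_graph n) (Suc a mod n) (a mod n)"
    and "adjacent (cycle_graph n) (a mod n) (Suc a mod n)"
proof -
  show "adjacent (cycle_graph n) (Suc a mod n) (a mod n)"
    using adjacent_cycle_graph_mod_iff[OF assms] by blast
  then show "adjacent (cycle_graph n) (a mod n) (Suc a mod n)"
    unfolding adjacent_def by (metis insert_commute)
qed

lemma dominating_run_with_tail:
  assumes S: "dominating_set (path_graph (n - k - 2)) S" and k: "k \<ge> 1" "k + 2 \<le> n"
  shows "dominating_set (cycle_graph n) (rotate_set n s (run_with_tail k S))"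
proof -
  let ?T = "run_with_tail k S"
  let ?D = "rotate_set n s ?T"
  have n: "n > 0" using k by simp
  have S_sub: "S \<subseteq> {..<n - k - 2}"
    using S by (simp add: dominating_set_def path_graph_def)
  have memI: "(s + y) mod n \<in> ?D" if "y \<in> ?T" for y
    using that by (auto simp: rotate_set_def)
  have "\<exists>u\<in>?D. adjacent (cycle_graph n) v u" if v: "v < n" "v \<notin> ?D" for v
  proof -
    obtain y where y: "y < n" "v = (s + y) mod n" using v(1) by (rule mod_add_surj)
    have yT: "y \<notin> ?T" using memI v(2) y(2) by auto
    \<comment> \<open>Before rotation no wrap-around arises: gap 0 is served by 1, gap
      \<open>Suc k\<close> by \<open>k\<close>, and a missing tail position by a path neighbour in
      \<open>S\<close>, which the shift keeps adjacent.\<close>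
    have "Suc y \<in> ?T \<or> (\<exists>z\<in>?T. y = Suc z)"
    proof -
      consider "y = 0" | "1 \<le> y \<and> y \<le> k" | "y = Suc k" | "k + 2 \<le> y" by linarith
      then show ?thesis
      proof cases
        case 1
        then show ?thesis using k run_mem_run_with_tail[of 1 k S] by simp
      next
        case 2
        then show ?thesis using yT run_mem_run_with_tail by blast
      next
        case 3
        then show ?thesis using k run_mem_run_with_tail[of k k S] by simp
      next
        case 4
        then obtain x where x: "y = x + k + 2" by (metis add.commute add.assoc le_Suc_ex)
        have "x \<notin> S" using yT x tail_mem_run_with_tail_iff by simp
        moreover have "x < n - k - 2" using x y(1) by simp
        ultimately obtain z where z: "z \<in> S" "adjacent (path_graph (n - k - 2)) x z"
          using S by (auto simp: dominating_set_def path_graph_def)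
        then have "z = Suc x \<or> x = Suc z"
          by (auto simp: adjacent_def path_graph_def doubleton_eq_iff)
        moreover have "z + k + 2 \<in> ?T" using z(1) tail_mem_run_with_tail_iff by blast
        ultimately show ?thesis using x by auto
      qed
    qed
    then show ?thesis
    proof
      assume "Suc y \<in> ?T"
      then show ?thesis
        using memI[of "Suc y"] adjacent_cycle_graph_Suc(2)[OF n, of "s + y"] y(2) by auto
    next
      assume "\<exists>z\<in>?T. y = Suc z"
      then obtain z where "z \<in> ?T" "y = Suc z" by blast
      then show ?thesis
        using memI[of z] adjacent_cycle_graph_Suc(1)[OF n, of "s + z"] y(2) by auto
    qed
  qed
  then show ?thesis
    using rotate_set_subset[OF n] by (auto simp: dominating_set_def cycle_graph_def)
qed

text \<open>Positions 1, 2, 3 contain the closed neighbourhood of position 2 and lie in the run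
  since \<open>k >= 3\<close>. A set avoiding them leaves position 2 undominated.\<close>

lemma accurate_run_with_tail:
  assumes S: "dominating_set (path_graph (n - k - 2)) S" and k: "k \<ge> 3" "k + 2 \<le> n"
  shows "accurate_dominating_set (cycle_graph n) (rotate_set n s (run_with_tail k S))"
proof -
  let ?D = "rotate_set n s (run_with_tail k S)"
  have n: "n > 0" using k by simp
  have D: "(s + y) mod n \<in> ?D" if "1 \<le> y" "y \<le> k" for y
    using run_mem_run_with_tail[OF that] by (auto simp: rotate_set_def)
  have three: "Suc s mod n \<in> ?D" "Suc (Suc s) mod n \<in> ?D" "Suc (Suc (Suc s)) mod n \<in> ?D"
    using D[of 1] D[of 2] D[of 3] k by (simp_all add: numeral_eq_Suc)
  have "\<not> dominating_set (cycle_graph n) D'" if "D' \<subseteq> verts (cycle_graph n) - ?D" for D'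
  proof
    assume dom: "dominating_set (cycle_graph n) D'"
    have "Suc (Suc s) mod n \<in> verts (cycle_graph n) - D'"
      using three(2) that n by (auto simp: cycle_graph_def)
    then obtain u where "u \<in> D'" "adjacent (cycle_graph n) (Suc (Suc s) mod n) u"
      using dom by (auto simp: dominating_set_def)
    then show False
      using three that adjacent_cycle_graph_mod_iff[OF n] by auto
  qed
  then show ?thesis
    using dominating_run_with_tail[OF S] k by (auto simp: accurate_dominating_set_def)
qed

section \<open>Uniqueness of the decomposition\<close>

text \<open>If \<open>t < t'\<close>, then \<open>s\<close> lies \<open>t' - t\<close> steps after
  \<open>s'\<close>, hence inside the second run. But \<open>s\<close> is the gap before the first
  run, and the two rotated sets agree.\<close>

lemma start_unique_aux:
  assumes T: "run_with_tail k S \<subseteq> {..<n}" and n: "n > 0" and t: "t \<le> t'" "t' \<le> k'"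
    and j: "(s + t) mod n = (s' + t') mod n"
    and D: "rotate_set n s (run_with_tail k S) = rotate_set n s' (run_with_tail k' S')"
  shows "t = t'"
proof (rule ccontr)
  assume "t \<noteq> t'"
  then have d: "1 \<le> t' - t" "t' - t \<le> k'" using t by auto
  \<comment> \<open>With \<open>t\<close> in front on both sides, cancellation locates
    \<open>s\<close> at offset \<open>t' - t\<close> from \<open>s'\<close>.\<close>
  have "(t + s) mod n = (t + (s' + (t' - t))) mod n"
    using j t by (simp add: ac_simps)
  then have "(t + s mod n) mod n = (t + (s' + (t' - t)) mod n) mod n"
    by (simp only: mod_add_right_eq)
  then have "s mod n = (s' + (t' - t)) mod n"
    using n by (metis mod_add_left_inj mod_less_divisor)
  also have "\<dots> \<in> rotate_set n s' (run_with_tail k' S')"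
    using run_mem_run_with_tail[OF d] by (auto simp: rotate_set_def)
  finally have "(s + 0) mod n \<in> rotate_set n s (run_with_tail k S)" using D by simp
  then show False
    using mem_rotate_set_iff[OF T n] gap_notin_run_with_tail(1) by blast
qed

lemma run_decomposition_unique:
  assumes T: "run_with_tail k S \<subseteq> {..<n}" "run_with_tail k' S' \<subseteq> {..<n}"
    and s: "s < n" "s' < n" and t: "t \<le> k" "t' \<le> k'"
    and j: "(s + t) mod n = (s' + t') mod n"
    and D: "rotate_set n s (run_with_tail k S) = rotate_set n s' (run_with_tail k' S')"
  shows "s = s' \<and> t = t' \<and> k = k' \<and> S = S'"
proof -
  have n: "n > 0" using s by simp
  \<comment> \<open>The two instances, with the roles exchanged, cover \<open>t <= t'\<close> and
    \<open>t' <= t\<close>.\<close>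
  have "t = t'"
    using start_unique_aux[OF T(1) n _ t(2) j D]
      start_unique_aux[OF T(2) n _ t(1) j[symmetric] D[symmetric]] by linarith
  moreover from this have "s = s'"
    using j s mod_add_left_inj[of s n s' t] by (simp add: add.commute)
  moreover from this have "run_with_tail k S = run_with_tail k' S'"
    using D T rotate_set_cancel by blast
  ultimately show ?thesis using run_with_tail_inject by blast
qed

section \<open>Double counting\<close>

text \<open>Both sides count sets with a marked vertex. On the left the mark is an offset
  \<open>t\<close> in the run, giving the weight \<open>k\<close>, and \<open>n\<close> counts the
  starts; on the right it is any of the \<open>i\<close> elements of an accurate set.\<close>

lemma weighted_path_count_le:
  fixes n i :: nat
  assumes "i + 1 \<le> n"
  shows "n * (\<Sum>k = 3..i - 1. k * num_dominating_sets (path_graph (n - k - 2)) (i - k))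
    \<le> i * num_accurate_dominating_sets (cycle_graph n) i"
proof -
  define P where "P k = {S. dominating_set (path_graph (n - k - 2)) S \<and> card S = i - k}" for k
  define A where "A = {D. accurate_dominating_set (cycle_graph n) D \<and> card D = i}"
  define X where "X = {..<n} \<times> (SIGMA k:{3..i - 1}. {1..k} \<times> P k)"
  define Y where "Y = (SIGMA D:A. D)"
  define f where "f = (\<lambda>(s, k, t, S). (rotate_set n s (run_with_tail k S), (s + t) mod n))"
  have P_sub: "S \<subseteq> {..<n - k - 2}" if "S \<in> P k" for k S
    using that by (simp add: P_def dominating_set_def path_graph_def)
  have finP: "finite (P k)" for k
    by (rule finite_subset[of _ "Pow {..<n - k - 2}"]) (use P_sub in auto)
  have A_sub: "D \<subseteq> {..<n}" if "D \<in> A" for D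
    using that by (simp add: A_def accurate_dominating_set_def dominating_set_def cycle_graph_def)
  have finA: "finite A"
    by (rule finite_subset[of _ "Pow {..<n}"]) (use A_sub in auto)
  have finD: "finite D" if "D \<in> A" for D
    using A_sub[OF that] by (rule finite_subset) simp
  \<comment> \<open>From \<open>k <= i - 1\<close> and \<open>i + 1 <= n\<close> there is room for
    the run and both gaps: \<open>k + 2 <= n\<close>.\<close>
  have T: "run_with_tail k S \<subseteq> {..<n}" if "k \<in> {3..i - 1}" "S \<in> P k" for k S
    using that assms by (intro run_with_tail_subset P_sub) auto
  have "inj_on f X"
  proof (rule inj_onI)
    fix p q assume p: "p \<in> X" and q: "q \<in> X" and eq: "f p = f q"
    obtain s k t S where p': "p = (s, k, t, S)" by (cases p)
    obtain s' k' t' S' where q': "q = (s', k', t', S')" by (cases q)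
    have "s = s' \<and> t = t' \<and> k = k' \<and> S = S'"
      using p q eq T unfolding p' q' X_def f_def
      by (intro run_decomposition_unique[of k S n k' S']) auto
    then show "p = q" unfolding p' q' by simp
  qed
  moreover have "f ` X \<subseteq> Y"
  proof
    fix z assume "z \<in> f ` X"
    then obtain s k t S where z: "z = f (s, k, t, S)" and
      s: "s < n" and k: "k \<in> {3..i - 1}" and t: "t \<in> {1..k}" and S: "S \<in> P k"
      by (auto simp: X_def)
    have finS: "finite S" using P_sub[OF S] by (rule finite_subset) simp
    let ?D = "rotate_set n s (run_with_tail k S)"
    have "accurate_dominating_set (cycle_graph n) ?D"
      using S k assms by (intro accurate_run_with_tail) (auto simp: P_def)
    \<comment> \<open>The cardinality is \<open>k + (i - k)\<close>, which is \<open>i\<close>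
      because \<open>k <= i - 1\<close>.\<close>
    moreover have "card ?D = i"
      using card_rotate_set[OF T[OF k S]] card_run_with_tail[OF finS] S k by (auto simp: P_def)
    moreover have "(s + t) mod n \<in> ?D"
      using t run_mem_run_with_tail[of t k S] by (auto simp: rotate_set_def)
    ultimately show "z \<in> Y" by (simp add: z f_def Y_def A_def)
  qed
  moreover have "finite Y" unfolding Y_def using finA finD by auto
  ultimately have "card X \<le> card Y" by (rule card_inj_on_le)
  moreover have "card X = n * (\<Sum>k = 3..i - 1. k * card (P k))"
    unfolding X_def using finP by (simp add: card_cartesian_product)
  moreover have "card Y = i * card A"
  proof -
    have "card Y = (\<Sum>D\<in>A. card D)" unfolding Y_def using finA finD by simp
    also have "\<dots> = (\<Sum>D\<in>A. i)" by (rule sum.cong) (auto simp: A_def)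
    finally show ?thesis by simp
  qed
  ultimately show ?thesis
    by (simp add: P_def A_def num_dominating_sets_def num_accurate_dominating_sets_def)
qed

theorem theorem4p4:
  fixes n i :: nat
  assumes "n \<ge> 6"
    and "n div 3 + 2 \<le> i"
    and "i \<le> n div 2"
  shows "num_accurate_dominating_sets (cycle_graph n) i
    \<ge> (\<Sum>k = 3..i - 1. (k + 2) * num_dominating_sets (path_graph (n - k - 2)) (i - k))"
proof -
  let ?d = "\<lambda>k. num_dominating_sets (path_graph (n - k - 2)) (i - k)"
  let ?a = "num_accurate_dominating_sets (cycle_graph n) i"
  have "(\<Sum>k = 3..i - 1. (k + 2) * ?d k) \<le> (\<Sum>k = 3..i - 1. 2 * (k * ?d k))"
    unfolding mult.assoc[symmetric] by (intro sum_mono mult_right_mono) auto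
  also have "\<dots> = 2 * (\<Sum>k = 3..i - 1. k * ?d k)"
    by (simp add: sum_distrib_left)
  \<comment> \<open>The factor \<open>n\<close> matches the double count; it is positive and is
    cancelled at the end.\<close>
  finally have "n * (\<Sum>k = 3..i - 1. (k + 2) * ?d k) \<le> n * (2 * (\<Sum>k = 3..i - 1. k * ?d k))"
    by (rule mult_left_mono) simp
  also have "\<dots> = 2 * (n * (\<Sum>k = 3..i - 1. k * ?d k))" by simp
  \<comment> \<open>The bound \<open>i + 1 <= n\<close> follows from \<open>i <= n div 2\<close> and
    \<open>n >= 6\<close>.\<close>
  also have "\<dots> \<le> 2 * (i * ?a)"
    using assms by (intro mult_left_mono weighted_path_count_le) auto
  also have "\<dots> \<le> n * ?a"
    unfolding mult.assoc[symmetric] using assms by (intro mult_right_mono) auto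
  finally show ?thesis using assms(1) by simp
qed

end
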